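(* Let $Z=(Z^+,Z^-)$ be a planar piecewise vector field with switching set $\Sigma=\{y=0\}$ satisfying hypothesis (H1) stated in the context, let $\mu\in\{-1,1\}$ be the associated sign and let $Z_b$, $b\in\mathbb{R}$, be the family $$Z_b(x,y)=\begin{cases} Z^+(x-b,y), & y>0,\\ Z^-(x,y), & y<0.\end{cases}$$ Then there is $b_0>0$ such that if $0<\mu b<b_0$, then $Z_b$ has at least one crossing periodic orbit in a neighborhood of the origin. Furthermore, if $(x^*(b),0)$, with $x^*(b)>0$, denotes an intersection of an existing limit cycle with $\Sigma$, then $x^*(b)>\max\{0,b\}$.
   Context: Setting. Let $\Sigma=\{(x,y)\in\mathbb{R}^2: y=0\}$ and $\Sigma^\pm=\{(x,y)\in\mathbb{R}^2:\pm y\geqslant 0\}$. Consider $Z(x,y)=Z^+(x,y)$ if $y>0$ and $Z(x,y)=Z^-(x,y)$ if $y<0$, where $Z^\pm=(P^\pm,Q^\pm)$ are well defined and locally Lipschitz on $\Sigma^\pm$. Let $\psi^\pm(t;x,y)$ be the solution of $Z^\pm$ with $\psi^\pm(0;x,y)=(x,y)$. Hypothesis (H1): there are $x_0>0$ and continuous functions $\tau^\pm:(0,x_0)\to\mathbb{R}$ such that for every $x\in(0,x_0)$: (i) $\psi^\pm(\tau^\pm(x);x,0)\in\Sigma$; (ii) $\tau^+(x)\tau^-(x)<0$; (iii) $\psi^\pm(t;x,0)\in\Sigma^\pm\setminus\Sigma$ for every $t$ in the open interval bounded by $0$ and $\tau^\pm(x)$; (iv) $\varphi^\pm(x)<0$,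 where $(\varphi^\pm(x),0):=\psi^\pm(\tau^\pm(x);x,0)$; (v) $\varphi^+(x)\neq\varphi^-(x)$; (vi) $\varphi^\pm$ extend continuously to $x=0$ with $\varphi^\pm(0)=0$. Signs: $\delta=1$ if $\tau^+(x)<0<\tau^-(x)$ and $\delta=-1$ if $\tau^-(x)<0<\tau^+(x)$ (independent of $x\in(0,x_0)$). Displacement function: $\Delta_0(x)=\delta(\varphi^+(x)-\varphi^-(x))$. Let $\sigma=\operatorname{sign}(\Delta_0(x))\in\{-1,1\}$ (independent of $x\in(0,x_0)$) and $\mu=-\sigma\delta$. Terminology: a crossing periodic orbit of $Z_b$ is a periodic orbit obtained by concatenating an orbit arc of the upper vector field $Z^+(x-b,y)$ in $\Sigma^+$ and an orbit arc of $Z^-$ in $\Sigma^-$, crossing $\Sigma$ without sliding. A limit cycle is an isolated periodic orbit. Since these arcs may be large, "in a neighborhood of the origin" refers to the intersection points of the orbit with $\Sigma$. *)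

theory Defs
  imports "HOL-Analysis.Analysis"
begin

type_synonym plane = "real \<times> real"
type_synonym field = "plane \<Rightarrow> plane"

definition switching_line :: "plane set" where
  "switching_line = {p. snd p = 0}"

definition upper_half :: "plane set" where
  "upper_half = {p. snd p \<ge> 0}"

definition lower_half :: "plane set" where
  "lower_half = {p. snd p \<le> 0}"

text \<open>
  A field is a total function, but only its values on the closed half-plane \<open>S\<close> matter:
  every notion below evaluates \<open>Z\<close> along curves contained in \<open>S\<close>. In particular derivatives are
  one-sided at the end points of \<open>I\<close>.
\<close>
definition solution_on :: "field \<Rightarrow> plane set \<Rightarrow> real set \<Rightarrow> (real \<Rightarrow> plane) \<Rightarrow> bool" where
  "solution_on Z S I \<gamma> \<longleftrightarrow>
     (\<forall>t\<in>I. \<gamma> t \<in> S \<and> (\<gamma> has_vector_derivative Z (\<gamma> t)) (at t within I))"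

definition locally_lipschitz_field :: "plane set \<Rightarrow> field \<Rightarrow> bool" where
  "locally_lipschitz_field S Z \<longleftrightarrow> local_lipschitz (UNIV :: real set) S (\<lambda>_. Z)"

text \<open>
  \<open>\<psi> t p\<close> is the solution with \<open>\<psi> 0 p = p\<close>; \<open>half_map \<psi> \<tau> x\<close> is the abscissa of
  \<open>\<psi> (\<tau> x) (x, 0)\<close>.
\<close>
definition half_map :: "(real \<Rightarrow> plane \<Rightarrow> plane) \<Rightarrow> (real \<Rightarrow> real) \<Rightarrow> real \<Rightarrow> real" where
  "half_map \<psi> \<tau> x = fst (\<psi> (\<tau> x) (x, 0))"

text \<open>
  The part of the hypothesis that concerns one field \<open>Z\<close> on its half-plane \<open>S\<close>. The values of
  \<open>\<psi>\<close> that occur are determined by \<open>Z\<close>, because solutions of a locally Lipschitz field are unique.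
  The time \<open>\<tau> x\<close> may have either sign.
\<close>
definition half_return ::
  "field \<Rightarrow> plane set \<Rightarrow> (real \<Rightarrow> plane \<Rightarrow> plane) \<Rightarrow> real \<Rightarrow> (real \<Rightarrow> real) \<Rightarrow> bool" where
  "half_return Z S \<psi> x0 \<tau> \<longleftrightarrow>
     continuous_on {0<..<x0} \<tau> \<and>
     (\<forall>x\<in>{0<..<x0}.
        \<psi> 0 (x, 0) = (x, 0) \<and>
        solution_on Z S (closed_segment 0 (\<tau> x)) (\<lambda>t. \<psi> t (x, 0)) \<and>
        \<psi> (\<tau> x) (x, 0) \<in> switching_line \<and>
        (\<forall>t\<in>open_segment 0 (\<tau> x). \<psi> t (x, 0) \<in> S - switching_line) \<and>
        half_map \<psi> \<tau> x < 0) \<and>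
     (half_map \<psi> \<tau> \<longlongrightarrow> 0) (at_right 0)"

definition H1 ::
  "field \<Rightarrow> field \<Rightarrow> (real \<Rightarrow> plane \<Rightarrow> plane) \<Rightarrow> (real \<Rightarrow> plane \<Rightarrow> plane) \<Rightarrow>
     real \<Rightarrow> (real \<Rightarrow> real) \<Rightarrow> (real \<Rightarrow> real) \<Rightarrow> bool" where
  "H1 Zp Zm \<psi>p \<psi>m x0 \<tau>p \<tau>m \<longleftrightarrow>
     x0 > 0 \<and>
     half_return Zp upper_half \<psi>p x0 \<tau>p \<and>
     half_return Zm lower_half \<psi>m x0 \<tau>m \<and>
     (\<forall>x\<in>{0<..<x0}. \<tau>p x * \<tau>m x < 0 \<and> half_map \<psi>p \<tau>p x \<noteq> half_map \<psi>m \<tau>m x)"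

text \<open>
  The signs \<open>\<delta>\<close>, \<open>\<sigma>\<close>, \<open>\<mu>\<close> are kept as functions of the point \<open>x\<close> at which they are evaluated; under
  the hypothesis \<open>H1\<close> they are constant on \<open>{0<..<x0}\<close>, and the \<open>else\<close> branch of \<open>delta_sign\<close> is the
  case \<open>\<tau>m x < 0 < \<tau>p x\<close>.
\<close>
definition delta_sign :: "(real \<Rightarrow> real) \<Rightarrow> (real \<Rightarrow> real) \<Rightarrow> real \<Rightarrow> real" where
  "delta_sign \<tau>p \<tau>m x = (if \<tau>p x < 0 \<and> 0 < \<tau>m x then 1 else -1)"

definition displacement ::
  "(real \<Rightarrow> plane \<Rightarrow> plane) \<Rightarrow> (real \<Rightarrow> plane \<Rightarrow> plane) \<Rightarrow>
     (real \<Rightarrow> real) \<Rightarrow> (real \<Rightarrow> real) \<Rightarrow> real \<Rightarrow> real" where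
  "displacement \<psi>p \<psi>m \<tau>p \<tau>m x =
     delta_sign \<tau>p \<tau>m x * (half_map \<psi>p \<tau>p x - half_map \<psi>m \<tau>m x)"

definition mu_sign ::
  "(real \<Rightarrow> plane \<Rightarrow> plane) \<Rightarrow> (real \<Rightarrow> plane \<Rightarrow> plane) \<Rightarrow>
     (real \<Rightarrow> real) \<Rightarrow> (real \<Rightarrow> real) \<Rightarrow> real \<Rightarrow> real" where
  "mu_sign \<psi>p \<psi>m \<tau>p \<tau>m x = - sgn (displacement \<psi>p \<psi>m \<tau>p \<tau>m x) * delta_sign \<tau>p \<tau>m x"

text \<open>A piecewise field is given by the pair of its upper and its lower field.\<close>
definition shifted_family :: "field \<Rightarrow> field \<Rightarrow> real \<Rightarrow> field \<times> field" where
  "shifted_family Zp Zm b = ((\<lambda>(x, y). Zp (x - b, y)), Zm)"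

definition orbit_arc :: "field \<Rightarrow> plane set \<Rightarrow> real \<Rightarrow> (real \<Rightarrow> plane) \<Rightarrow> bool" where
  "orbit_arc Z S T \<gamma> \<longleftrightarrow>
     0 < T \<and> solution_on Z S {0..T} \<gamma> \<and>
     \<gamma> 0 \<in> switching_line \<and> \<gamma> T \<in> switching_line \<and>
     (\<forall>t\<in>{0<..<T}. \<gamma> t \<in> S - switching_line)"

text \<open>
  Both arcs are run through forward in time, so at each of the two points on the switching line the
  orbit passes from one open half-plane into the other. There the second components of the two fields
  have product \<open>\<ge> 0\<close>, so neither point is a sliding or escaping point (product \<open>< 0\<close>). Strict
  transversality (product \<open>> 0\<close>) is not required, since \<open>H1\<close> permits half-return orbits that
  meet the switching line tangentially, for instance with cubic contact. The end points of the arcs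
  are distinct, so the orbit is a simple closed curve.
\<close>
definition crossing_periodic_orbit :: "field \<times> field \<Rightarrow> plane set \<Rightarrow> bool" where
  "crossing_periodic_orbit W \<Gamma> \<longleftrightarrow>
     (\<exists>T1 T2 \<gamma>1 \<gamma>2.
        orbit_arc (fst W) upper_half T1 \<gamma>1 \<and> orbit_arc (snd W) lower_half T2 \<gamma>2 \<and>
        \<gamma>1 T1 = \<gamma>2 0 \<and> \<gamma>2 T2 = \<gamma>1 0 \<and> \<gamma>1 0 \<noteq> \<gamma>1 T1 \<and>
        \<Gamma> = \<gamma>1 ` {0..T1} \<union> \<gamma>2 ` {0..T2})"

definition limit_cycle :: "field \<times> field \<Rightarrow> plane set \<Rightarrow> bool" where
  "limit_cycle W \<Gamma> \<longleftrightarrow>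
     crossing_periodic_orbit W \<Gamma> \<and>
     (\<exists>U. open U \<and> \<Gamma> \<subseteq> U \<and>
        (\<forall>\<Gamma>'. crossing_periodic_orbit W \<Gamma>' \<and> \<Gamma>' \<subseteq> U \<longrightarrow> \<Gamma>' = \<Gamma>))"

end

theory Submission
  imports Defs
begin

text \<open>
  A zero of \<open>b + \<phi>\<^sup>+(x - b) - \<phi>\<^sup>-(x)\<close> closes up an orbit of \<open>Z\<^sub>b\<close>. At \<open>x = max 0 b\<close> this
  displacement has the sign of \<open>b\<close>, and at a fixed small \<open>x\<close> it keeps the sign of
  \<open>\<phi>\<^sup>+ - \<phi>\<^sup>-\<close> for small \<open>b\<close>. The factor \<open>\<delta>\<close> cancels in \<open>\<mu> = -\<sigma>\<delta>\<close>, so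
  \<open>\<mu> b > 0\<close> says that these signs differ, and the intermediate value theorem applies.

  For the location of a cycle only \<open>0 < x\<^sup>* \<le> b\<close> has to be excluded. By uniqueness its lower arc is
  the one through \<open>(x\<^sup>*, 0)\<close> given by \<open>H1\<close>, so its other end is \<open>(\<phi>\<^sup>-(x\<^sup>*), 0)\<close>. For small \<open>b\<close> we
  have \<open>\<phi>\<^sup>-(x\<^sup>*) - b = \<phi>\<^sup>+(y)\<close> for some \<open>y > 0\<close>, and uniqueness for the upper arc gives
  \<open>x\<^sup>* - b = y > 0\<close>.
\<close>

section \<open>Solutions of locally Lipschitz fields\<close>

text \<open>The squared norm is differentiable even where \<open>d\<close> vanishes. As
  \<open>2 * (norm (d t) * c)\<close> is at most \<open>(norm (d t))\<^sup>2 + c\<^sup>2\<close>,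
  the added constant \<open>c\<^sup>2\<close> absorbs the inhomogeneity, and the damped sum
  \<open>g\<close> does not increase.\<close>

lemma gronwall_sq:
  fixes d d' :: "real \<Rightarrow> 'a::real_inner"
  assumes s: "0 \<le> s" and A: "0 \<le> A"
    and der: "\<And>t. t \<in> {0..s} \<Longrightarrow> (d has_vector_derivative d' t) (at t within {0..s})"
    and bound: "\<And>t. t \<in> {0..s} \<Longrightarrow> norm (d' t) \<le> A * norm (d t) + c"
  shows "(norm (d s))\<^sup>2 \<le> ((norm (d 0))\<^sup>2 + c\<^sup>2) * exp ((2 * A + 1) * s)"
proof -
  define B where "B = 2 * A + 1"
  define g where "g = (\<lambda>t. (d t \<bullet> d t + c\<^sup>2) * exp (- (B * t)))"
  have cont: "continuous_on {0..s} d"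
    by (rule continuous_on_vector_derivative[OF der])
  have "g s \<le> g 0"
  proof (rule DERIV_nonpos_imp_decreasing_open[OF s])
    show "continuous_on {0..s} g"
      unfolding g_def by (intro continuous_intros cont)
  next
    fix t assume t: "0 < t" "t < s"
    then have "(d has_vector_derivative d' t) (at t)"
      using der[of t] by (auto simp: at_within_Icc_at)
    then have "((\<lambda>t. d t \<bullet> d t) has_real_derivative (2 * (d t \<bullet> d' t))) (at t)"
      unfolding has_vector_derivative_def has_field_derivative_def
      by (auto intro!: derivative_eq_intros simp: inner_commute algebra_simps)
    then have *: "(g has_real_derivative
        (2 * (d t \<bullet> d' t) - B * (d t \<bullet> d t + c\<^sup>2)) * exp (- (B * t))) (at t)"
      unfolding g_def by (auto intro!: derivative_eq_intros simp: algebra_simps)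
    have "d t \<bullet> d' t \<le> norm (d t) * norm (d' t)"
      by (rule norm_cauchy_schwarz)
    also have "\<dots> \<le> norm (d t) * (A * norm (d t) + c)"
      using bound[of t] t by (intro mult_left_mono) auto
    finally have 1: "2 * (d t \<bullet> d' t) \<le> 2 * A * (norm (d t))\<^sup>2 + 2 * (norm (d t) * c)"
      by (simp add: algebra_simps power2_eq_square)
    have 2: "2 * (norm (d t) * c) \<le> (norm (d t))\<^sup>2 + c\<^sup>2"
      using sum_squares_bound[of "norm (d t)" c] by (simp add: algebra_simps)
    show "\<exists>y. (g has_real_derivative y) (at t) \<and> y \<le> 0"
    proof (intro exI conjI, rule *)
      have "2 * (d t \<bullet> d' t) - B * (d t \<bullet> d t + c\<^sup>2) \<le> - (2 * A * c\<^sup>2)"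
        using 1 2 by (simp add: B_def dot_square_norm algebra_simps)
      also have "\<dots> \<le> 0"
        using A by simp
      finally
 show "(2 * (d t \<bullet> d' t) - B * (d t \<bullet> d t + c\<^sup>2)) * exp (- (B * t)) \<le> 0"
        by (simp add: mult_nonpos_nonneg)
    qed
  qed
  then have "(d s \<bullet> d s + c\<^sup>2) * exp (- (B * s)) * exp (B * s) \<le> (d 0 \<bullet> d 0 + c\<^sup>2) * exp (B * s)"
    unfolding g_def by (intro mult_right_mono) simp_all
  moreover have "exp (- (B * s)) * exp (B * s) = 1"
    by (simp flip: exp_add)
  ultimately have "d s \<bullet> d s + c\<^sup>2 \<le> (d 0 \<bullet> d 0 + c\<^sup>2) * exp (B * s)"
    by (simp only: mult.assoc mult_1_right)
  moreover have "0 \<le> c\<^sup>2" by simp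
  ultimately show ?thesis
    unfolding B_def dot_square_norm by linarith
qed

lemma solution_on_continuous: "solution_on Z S I \<gamma> \<Longrightarrow> continuous_on I \<gamma>"
  unfolding solution_on_def by (rule continuous_on_vector_derivative) blast

text \<open>The one change of time variable behind reversal (\<open>c = -1\<close>), rescaling to
  unit time, and restriction to an initial part of an arc (\<open>0 < c \<le> 1\<close>).\<close>

lemma solution_on_affine:
  assumes sol: "solution_on Z S I \<gamma>" and sub: "(\<lambda>s. a + c * s) ` J \<subseteq> I"
  shows "solution_on (\<lambda>p. c *\<^sub>R Z p) S J (\<lambda>s. \<gamma> (a + c * s))"
  unfolding solution_on_def
proof (intro ballI conjI)
  fix s assume s: "s \<in> J"
  then have I: "a + c * s \<in> I" using sub by auto
  then show "\<gamma> (a + c * s) \<in> S" using sol by (auto simp: solution_on_def)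
  have "((\<lambda>s. a + c * s) has_vector_derivative c) (at s within J)"
    by (auto intro!: derivative_eq_intros)
  moreover have "(\<gamma> has_vector_derivative Z (\<gamma> (a + c * s))) (at (a + c * s) within (\<lambda>s. a + c * s) ` J)"
    using sol I sub by (auto simp: solution_on_def intro: has_vector_derivative_within_subset)
  ultimately show "((\<lambda>s. \<gamma> (a + c * s)) has_vector_derivative c *\<^sub>R Z (\<gamma> (a + c * s))) (at s within J)"
    using vector_diff_chain_within by (fastforce simp: o_def)
qed

lemma locally_lipschitz_on_compact:
  assumes "locally_lipschitz_field S Z" "compact K" "K \<subseteq> S"
  obtains L where "0 \<le> L" "\<And>p q. p \<in> K \<Longrightarrow> q \<in> K \<Longrightarrow> norm (Z p - Z q) \<le> L * norm (p - q)"
proof -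
  have "local_lipschitz {0::real} K (\<lambda>_. Z)"
    using assms local_lipschitz_subset[of UNIV S "\<lambda>_. Z"] by (auto simp: locally_lipschitz_field_def)
  then obtain L where "L-lipschitz_on K Z"
    using local_lipschitz_compact_implies_lipschitz[of "{0::real}" K "\<lambda>_. Z"] assms(2) by auto
  then show ?thesis
    using that[of L] lipschitz_onD[of L K Z] lipschitz_on_nonneg[of L K Z] by (auto simp: dist_norm)
qed

text \<open>Gronwall with inhomogeneity \<open>0\<close>: both images lie in one compact subset of
  \<open>S\<close>, where a single Lipschitz constant serves, so the difference stays
  \<open>0\<close>.\<close>

lemma solution_on_unique:
  assumes ll: "locally_lipschitz_field S Z"
    and u: "solution_on (\<lambda>p. T *\<^sub>R Z p) S {0..1} u"
    and v: "solution_on (\<lambda>p. T *\<^sub>R Z p) S {0..1} v"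
    and eq: "u 0 = v 0" and s: "s \<in> {0..1}"
  shows "u s = v s"
proof -
  have "compact (u ` {0..1} \<union> v ` {0..1})"
    using u v by (intro compact_Un compact_continuous_image) (auto intro: solution_on_continuous)
  moreover have "u ` {0..1} \<union> v ` {0..1} \<subseteq> S"
    using u v by (auto simp: solution_on_def)
  ultimately obtain L where L: "0 \<le> L"
    "\<And>p q. p \<in> u ` {0..1} \<union> v ` {0..1} \<Longrightarrow> q \<in> u ` {0..1} \<union> v ` {0..1} \<Longrightarrow>
       norm (Z p - Z q) \<le> L * norm (p - q)"
    using locally_lipschitz_on_compact[OF ll] by blast
  have "(norm (u s - v s))\<^sup>2 \<le> ((norm (u 0 - v 0))\<^sup>2 + 0\<^sup>2) * exp ((2 * (\<bar>T\<bar> * L) + 1) * s)"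
  proof (rule gronwall_sq[where d' = "\<lambda>t. T *\<^sub>R Z (u t) - T *\<^sub>R Z (v t)"])
    fix t assume t: "t \<in> {0..s}"
    with s have "t \<in> {0..1}" "{0..s} \<subseteq> {0..1}" by auto
    then show "((\<lambda>t. u t - v t) has_vector_derivative T *\<^sub>R Z (u t) - T *\<^sub>R Z (v t)) (at t within {0..s})"
      using u v unfolding solution_on_def
      by (blast intro: has_vector_derivative_diff has_vector_derivative_within_subset)
    have "norm (T *\<^sub>R Z (u t) - T *\<^sub>R Z (v t)) = \<bar>T\<bar> * norm (Z (u t) - Z (v t))"
      by (metis norm_scaleR scaleR_right_diff_distrib)
    also have "\<dots> \<le> \<bar>T\<bar> * (L * norm (u t - v t))"
      using L(2) \<open>t \<in> {0..1}\<close> by (intro mult_left_mono) auto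
    finally show "norm (T *\<^sub>R Z (u t) - T *\<^sub>R Z (v t)) \<le> \<bar>T\<bar> * L * norm (u t - v t) + 0"
      by simp
  qed (use s L in auto)
  then show ?thesis using eq by simp
qed

section \<open>Continuous dependence on starting point and duration\<close>

text \<open>At the first time at which \<open>f\<close> equals \<open>1\<close>, \<open>step\<close>
  applies and contradicts the equality. This turns an estimate valid only while two solutions stay
  within distance \<open>1\<close> into one on the whole unit interval.\<close>

lemma continuous_induction_bound:
  fixes f :: "real \<Rightarrow> real"
  assumes cont: "continuous_on {0..1} f" and f0: "f 0 < 1"
    and step: "\<And>s. s \<in> {0..1} \<Longrightarrow> (\<And>t. t \<in> {0..s} \<Longrightarrow> f t \<le> 1) \<Longrightarrow> f s < 1"
    and s: "s \<in> {0..1}"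
  shows "f s < 1"
proof (rule ccontr)
  have hit: "\<exists>x\<in>{0..t}. f x = 1" if "t \<in> {0..1}" "1 \<le> f t" for t
  proof -
    have "continuous_on {0..t} f" using that by (auto intro: continuous_on_subset[OF cont])
    then show ?thesis using IVT'[of f 0 1 t] that f0 by auto
  qed
  define C where "C = {t \<in> {0..1}. f t = 1}"
  assume "\<not> f s < 1"
  then obtain x where "x \<in> {0..s}" "f x = 1" using hit[of s] s by auto
  then have "x \<in> C" using s by (simp add: C_def)
  then have "C \<noteq> {}" by blast
  moreover have "compact C"
  proof -
    have "closed ({0..1} \<inter> f -` {1})"
      by (rule continuous_closed_preimage[OF cont closed_atLeastAtMost closed_singleton])
    then have "compact ({0..1} \<inter> ({0..1} \<inter> f -` {1}))"
      by (rule compact_Int_closed[OF compact_Icc])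
    moreover have "{0..1} \<inter> ({0..1} \<inter> f -` {1}) = C" by (auto simp: C_def)
    ultimately show ?thesis by simp
  qed
  ultimately obtain m where m: "m \<in> C" "\<And>t. t \<in> C \<Longrightarrow> m \<le> t"
    using compact_attains_inf[of C] by blast
  have "f t \<le> 1" if t: "t \<in> {0..m}" for t
  proof (rule ccontr)
    assume "\<not> f t \<le> 1"
    moreover have "t \<in> {0..1}" "f m = 1" using t m(1) by (auto simp: C_def)
    ultimately have "\<exists>x\<in>{0..t}. f x = 1" "t \<noteq> m" using hit[of t] by auto
    then obtain x where x: "x \<in> {0..t}" "f x = 1" and "t < m" using t by auto
    then have "x \<in> C" "x < m" using m(1) by (auto simp: C_def)
    then show False using m(2)[of x] by simp
  qed
  moreover have "m \<in> {0..1}" using m(1) by (simp add: C_def)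
  ultimately have "f m < 1" using step[of m] by blast
  then show False using m(1) by (simp add: C_def)
qed

text \<open>
  Rescaling time to the unit interval moves the varying duration into the field, so that a single
  Gronwall estimate with inhomogeneity \<open>\<bar>T x - T y\<bar> * M\<close> compares two arcs of different length.
\<close>
lemma solution_endpoint_continuous:
  fixes u :: "'a::topological_space \<Rightarrow> real \<Rightarrow> plane"
  assumes ll: "locally_lipschitz_field S Z" and S: "closed S"
    and T: "continuous_on I T"
    and u0: "continuous_on I (\<lambda>x. u x 0)"
    and u: "\<And>x. x \<in> I \<Longrightarrow> solution_on (\<lambda>p. T x *\<^sub>R Z p) S {0..1} (u x)"
  shows "continuous_on I (\<lambda>x. u x 1)"
  unfolding continuous_on_def
proof
  fix x assume x: "x \<in> I"
  define K where "K = u x ` {0..1}"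
  have ux: "continuous_on {0..1} (u x)"
    by (rule solution_on_continuous[OF u[OF x]])
  have K: "compact K" "K \<noteq> {}" "K \<subseteq> S"
  proof -
    show "compact K"
      unfolding K_def by (rule compact_continuous_image[OF ux compact_Icc])
    show "K \<noteq> {}" by (simp add: K_def)
    show "K \<subseteq> S" using u[OF x] unfolding K_def solution_on_def by blast
  qed
  \<comment> \<open>A compact neighbourhood of the reference arc in \<open>S\<close>. Every arc
    within distance \<open>1\<close> of it lies in \<open>K'\<close>, so one constant
    \<open>L\<close> serves for all nearby \<open>y\<close>.\<close>
  define K' where "K' = S \<inter> {p. infdist p K \<le> 1}"
  have "compact K'"
    unfolding K'_def using S compact_infdist_le[OF K(2,1), of 1] by (simp add: closed_Int_compact)
  moreover have "K' \<subseteq> S" by (simp add: K'_def)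
  ultimately obtain L where L: "0 \<le> L"
    "\<And>p q. p \<in> K' \<Longrightarrow> q \<in> K' \<Longrightarrow> norm (Z p - Z q) \<le> L * norm (p - q)"
    using locally_lipschitz_on_compact[OF ll] by blast
  have "bounded (Z ` K)"
  proof -
    have "K \<subseteq> K'" using K(3) by (auto simp: K'_def)
    then have "L-lipschitz_on K Z"
      using L by (intro lipschitz_onI) (auto simp only: dist_norm subset_iff)
    then show ?thesis 
      by (intro compact_imp_bounded compact_continuous_image K(1) lipschitz_on_continuous_on)
  qed
  \<comment> \<open>A bound on the reference arc alone suffices, because the splitting used in
    \<open>key\<close> attaches the factor \<open>T x - T y\<close> to
    \<open>Z (u x t)\<close>.\<close>
  then obtain M where M: "\<And>p. p \<in> K \<Longrightarrow> norm (Z p) \<le> M"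
    by (auto simp: bounded_iff)
  \<comment> \<open>The Gronwall bound made uniform in the time: \<open>s\<close> is replaced by
    \<open>1\<close> and \<open>\<bar>T y\<bar>\<close> by \<open>\<bar>T x\<bar> + 1\<close>. It
    tends to \<open>0\<close> as \<open>y\<close> approaches \<open>x\<close>.\<close>
  define R where "R = (\<lambda>y. ((norm (u x 0 - u y 0))\<^sup>2 + (\<bar>T x - T y\<bar> * M)\<^sup>2) * exp (2 * ((\<bar>T x\<bar> + 1) * L) + 1))"
  have "(R \<longlongrightarrow> ((norm (u x 0 - u x 0))\<^sup>2 + (\<bar>T x - T x\<bar> * M)\<^sup>2) * exp (2 * ((\<bar>T x\<bar> + 1) * L) + 1)) (at x within I)"
    unfolding R_def using T u0 x by (intro tendsto_intros) (simp_all add: continuous_on_def)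
  then have R: "(R \<longlongrightarrow> 0) (at x within I)" by simp
  have key: "(norm (u x s - u y s))\<^sup>2 \<le> R y"
    if y: "y \<in> I" and Ty: "\<bar>T y\<bar> \<le> \<bar>T x\<bar> + 1" and s: "s \<in> {0..1}"
      and near: "\<And>t. t \<in> {0..s} \<Longrightarrow> norm (u x t - u y t) \<le> 1" for y s
  proof -
    have "(norm (u x s - u y s))\<^sup>2 \<le> ((norm (u x 0 - u y 0))\<^sup>2 + (\<bar>T x - T y\<bar> * M)\<^sup>2) *
        exp ((2 * ((\<bar>T x\<bar> + 1) * L) + 1) * s)"
    proof (rule gronwall_sq[where d' = "\<lambda>t. T x *\<^sub>R Z (u x t) - T y *\<^sub>R Z (u y t)"])
      fix t assume t: "t \<in> {0..s}"
      with s have t1: "t \<in> {0..1}" "{0..s} \<subseteq> {0..1}" by auto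
      then show "((\<lambda>t. u x t - u y t) has_vector_derivative T x *\<^sub>R Z (u x t) - T y *\<^sub>R Z (u y t)) (at t within {0..s})"
        using u[OF x] u[OF y] unfolding solution_on_def
        by (blast intro: has_vector_derivative_diff has_vector_derivative_within_subset)
      have xK: "u x t \<in> K" using t1 by (auto simp: K_def)
      moreover have "infdist (u y t) K \<le> 1"
        using infdist_le2[OF xK] near[OF t] by (simp add: dist_norm norm_minus_commute)
      ultimately have "u x t \<in> K'" "u y t \<in> K'"
        using u[OF y] t1 K by (auto simp: K'_def solution_on_def)
      then have Lip: "norm (Z (u x t) - Z (u y t)) \<le> L * norm (u x t - u y t)" by (rule L(2))
      have "T x *\<^sub>R Z (u x t) - T y *\<^sub>R Z (u y t) =
          T y *\<^sub>R (Z (u x t) - Z (u y t)) + (T x - T y) *\<^sub>R Z (u x t)"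
        by (simp add: algebra_simps)
      also have "norm \<dots> \<le> \<bar>T y\<bar> * norm (Z (u x t) - Z (u y t)) + \<bar>T x - T y\<bar> * norm (Z (u x t))"
        by (metis norm_scaleR norm_triangle_ineq)
      also have "\<dots> \<le> (\<bar>T x\<bar> + 1) * (L * norm (u x t - u y t)) + \<bar>T x - T y\<bar> * M"
        using Lip Ty M[OF xK] L(1) by (intro add_mono mult_mono) auto
      finally show "norm (T x *\<^sub>R Z (u x t) - T y *\<^sub>R Z (u y t)) \<le>
          (\<bar>T x\<bar> + 1) * L * norm (u x t - u y t) + \<bar>T x - T y\<bar> * M"
        by simp
    qed (use s L in auto)
    also have "\<dots> \<le> R y"
      unfolding R_def using s L(1)
      by (intro mult_left_mono) (auto intro!: mult_right_le_one_le)
    finally show ?thesis .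
  qed
  have ev: "\<forall>\<^sub>F y in at x within I. R y < 1" "\<forall>\<^sub>F y in at x within I. \<bar>T y\<bar> < \<bar>T x\<bar> + 1"
  proof -
    show "\<forall>\<^sub>F y in at x within I. R y < 1"
      by (rule order_tendstoD(2)[OF R]) simp
    have "((\<lambda>y. \<bar>T y\<bar>) \<longlongrightarrow> \<bar>T x\<bar>) (at x within I)"
      using T x by (intro tendsto_rabs) (simp add: continuous_on_def)
    then show "\<forall>\<^sub>F y in at x within I. \<bar>T y\<bar> < \<bar>T x\<bar> + 1"
      by (rule order_tendstoD(2)) simp
  qed
  have inI: "\<forall>\<^sub>F y in at x within I. y \<in> I"
    by (simp add: eventually_at_filter)
  have bound: "(norm (u x 1 - u y 1))\<^sup>2 \<le> R y"
    if y: "y \<in> I" and Ty: "\<bar>T y\<bar> < \<bar>T x\<bar> + 1" and Ry: "R y < 1" for y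
  proof -
    \<comment> \<open>As \<open>R y < 1\<close>, distance at most \<open>1\<close> up to time
      \<open>s\<close> improves to distance less than \<open>1\<close> at \<open>s\<close>. The
      induction can start because \<open>R y\<close> also dominates the squared initial
      distance.\<close>
    have small: "norm (u x s - u y s) < 1"
      if "s \<in> {0..1}" "\<And>t. t \<in> {0..s} \<Longrightarrow> norm (u x t - u y t) \<le> 1" for s
      using key[OF y _ that] Ty Ry abs_square_less_1[of "norm (u x s - u y s)"] by simp
    have cont: "continuous_on {0..1} (\<lambda>s. norm (u x s - u y s))"
      using u x y by (intro continuous_intros) (auto intro: solution_on_continuous)
    have "(norm (u x 0 - u y 0))\<^sup>2 \<le> R y"
    proof -
      have "(norm (u x 0 - u y 0))\<^sup>2 * 1 \<le> R y"
        unfolding R_def using L(1) by (intro mult_mono) auto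
      then show ?thesis by simp
    qed
    then have "norm (u x 0 - u y 0) < 1"
      using Ry abs_square_less_1[of "norm (u x 0 - u y 0)"] by simp
    from continuous_induction_bound[OF cont this small]
    have "norm (u x s - u y s) < 1" if "s \<in> {0..1}" for s using that by blast
    then show ?thesis using Ty by (intro key y) (auto intro: less_imp_le)
  qed
  have "((\<lambda>y. (norm (u x 1 - u y 1))\<^sup>2) \<longlongrightarrow> 0) (at x within I)"
  proof (rule tendsto_sandwich[OF _ _ tendsto_const R])
    show "\<forall>\<^sub>F y in at x within I. (norm (u x 1 - u y 1))\<^sup>2 \<le> R y"
      using ev(1) ev(2) inI
      by eventually_elim (rule bound)
  qed auto
  then have "((\<lambda>y. sqrt ((norm (u x 1 - u y 1))\<^sup>2)) \<longlongrightarrow> sqrt 0) (at x within I)"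
    by (rule tendsto_real_sqrt)
  then have "((\<lambda>y. dist (u y 1) (u x 1)) \<longlongrightarrow> 0) (at x within I)"
    by (simp add: dist_norm norm_minus_commute)
  then show "((\<lambda>y. u y 1) \<longlongrightarrow> u x 1) (at x within I)"
    by (rule tendsto_dist_iff[THEN iffD2])
qed

section \<open>Arcs rescaled to unit time\<close>

text \<open>
  The sign of \<open>T\<close> is the direction of time; the arc takes the time \<open>\<bar>T\<bar>\<close>.
\<close>
definition unit_arc :: "field \<Rightarrow> plane set \<Rightarrow> real \<Rightarrow> (real \<Rightarrow> plane) \<Rightarrow> bool" where
  "unit_arc Z S T u \<longleftrightarrow> T \<noteq> 0 \<and> solution_on (\<lambda>p. T *\<^sub>R Z p) S {0..1} u \<and>
     u 0 \<in> switching_line \<and> u 1 \<in> switching_line \<and> (\<forall>s\<in>{0<..<1}. u s \<notin> switching_line)"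

lemma unit_arc_reverse:
  assumes "unit_arc Z S T u"
  shows "unit_arc Z S (- T) (\<lambda>s. u (1 - s))"
proof -
  have "solution_on (\<lambda>p. (-1) *\<^sub>R T *\<^sub>R Z p) S {0..1} (\<lambda>s. u (1 + (-1) * s))"
    using assms by (intro solution_on_affine[of _ _ "{0..1}"]) (auto simp: unit_arc_def)
  then show ?thesis using assms by (simp add: unit_arc_def)
qed

lemma orbit_arc_imp_unit_arc:
  assumes "orbit_arc Z S T \<gamma>"
  shows "unit_arc Z S T (\<lambda>s. \<gamma> (T * s))"
proof -
  have T: "0 < T" using assms by (simp add: orbit_arc_def)
  have "solution_on (\<lambda>p. T *\<^sub>R Z p) S {0..1} (\<lambda>s. \<gamma> (0 + T * s))"
    using assms T by (intro solution_on_affine[of _ _ "{0..T}"])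
      (auto simp: orbit_arc_def mult_left_le)
  then show ?thesis using assms T by (simp add: unit_arc_def orbit_arc_def)
qed

lemma unit_arc_imp_orbit_arc:
  assumes u: "unit_arc Z S T u" and T: "0 < T"
  shows "orbit_arc Z S T (\<lambda>t. u (t / T))"
proof -
  have "solution_on (\<lambda>p. (1 / T) *\<^sub>R T *\<^sub>R Z p) S {0..T} (\<lambda>t. u (0 + (1 / T) * t))"
    using u T by (intro solution_on_affine[of _ _ "{0..1}"]) (auto simp: unit_arc_def)
  then have sol: "solution_on Z S {0..T} (\<lambda>t. u (t / T))" using T by simp
  have "u (t / T) \<in> S - switching_line" if "t \<in> {0<..<T}" for t
    using u sol that T by (auto simp: unit_arc_def solution_on_def)
  then show ?thesis using u T sol by (simp add: orbit_arc_def unit_arc_def)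
qed

lemma half_return_unit_arc:
  assumes h: "half_return Z S \<psi> x0 \<tau>" and x: "x \<in> {0<..<x0}" and \<tau>: "\<tau> x \<noteq> 0"
  shows "unit_arc Z S (\<tau> x) (\<lambda>s. \<psi> (\<tau> x * s) (x, 0))"
proof -
  have seg: "closed_segment 0 (\<tau> x) = (\<lambda>s. \<tau> x * s) ` {0..1}"
    by (auto simp: closed_segment_def image_iff mult.commute)
  have "solution_on (\<lambda>p. \<tau> x *\<^sub>R Z p) S {0..1} (\<lambda>s. \<psi> (0 + \<tau> x * s) (x, 0))"
    by (rule solution_on_affine[of _ _ "closed_segment 0 (\<tau> x)"])
      (use h x in \<open>simp_all add: half_return_def, simp add: seg\<close>)
  moreover have "\<tau> x * s \<in> open_segment 0 (\<tau> x)" if "s \<in> {0<..<1}" for s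
    using that \<tau> by (auto simp: in_segment mult.commute)
  moreover have "(x, 0::real) \<in> switching_line" by (simp add: switching_line_def)
  ultimately show ?thesis using h x \<tau> by (auto simp: unit_arc_def half_return_def)
qed

section \<open>Uniqueness and translation of arcs\<close>

text \<open>Followed only for the fraction \<open>r = T / T'\<close> of its time, the longer arc
  coincides with the shorter one. It is then on the switching line at time \<open>r\<close>, which
  its interior avoids, so \<open>r = 1\<close>.\<close>

lemma unit_arc_unique_shorter:
  assumes ll: "locally_lipschitz_field S Z"
    and u: "unit_arc Z S T u" and v: "unit_arc Z S T' v"
    and eq: "u 0 = v 0" and T: "0 < T * T'" "\<bar>T\<bar> \<le> \<bar>T'\<bar>"
  shows "T = T' \<and> u 1 = v 1"
proof -
  define r where "r = T / T'"
  have nz: "T' \<noteq> 0" using T(1) by auto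
  have "0 < r" using T(1) by (auto simp: r_def zero_less_divide_iff zero_less_mult_iff)
  moreover have "\<bar>r\<bar> \<le> 1" using T(2) nz by (simp add: r_def divide_le_eq)
  ultimately have r: "0 < r" "r \<le> 1" by auto
  have rT: "r * T' = T" using nz by (simp add: r_def)
  have "(\<lambda>s. 0 + r * s) ` {0..1} \<subseteq> {0..1}" using r by (auto simp: mult_le_one)
  then have "solution_on (\<lambda>p. r *\<^sub>R T' *\<^sub>R Z p) S {0..1} (\<lambda>s. v (0 + r * s))"
    using v by (intro solution_on_affine[of _ _ "{0..1}"]) (auto simp: unit_arc_def)
  then have "solution_on (\<lambda>p. T *\<^sub>R Z p) S {0..1} (\<lambda>s. v (r * s))" using rT by simp
  moreover have "solution_on (\<lambda>p. T *\<^sub>R Z p) S {0..1} u" using u by (simp add: unit_arc_def)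
  ultimately have "u 1 = v (r * 1)"
    using eq solution_on_unique[OF ll, of T u "\<lambda>s. v (r * s)" 1] by simp
  then have v1: "u 1 = v r" by simp
  then have "v r \<in> switching_line" using u by (simp add: unit_arc_def)
  then have "r \<notin> {0<..<1}" using v by (auto simp: unit_arc_def)
  then have "r = 1" using r by simp
  then show ?thesis using rT v1 by simp
qed

lemma unit_arc_unique:
  assumes ll: "locally_lipschitz_field S Z"
    and u: "unit_arc Z S T u" and v: "unit_arc Z S T' v"
    and eq: "u 0 = v 0" and T: "0 < T * T'"
  shows "u 1 = v 1"
proof (cases "\<bar>T\<bar> \<le> \<bar>T'\<bar>")
  case True
  then show ?thesis using unit_arc_unique_shorter[OF ll u v eq T] by simp
next
  case False
  then show ?thesis using unit_arc_unique_shorter[OF ll v u] eq T by (simp add: mult.commute)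
qed

text \<open>Horizontal translation preserves the half-plane and the switching line. This transfers
  what \<open>H1\<close> says about \<open>Zp\<close> to the upper field of the shifted
  family.\<close>

lemma unit_arc_translate:
  "unit_arc (\<lambda>(x, y). Z (x - b, y)) upper_half T u \<longleftrightarrow>
   unit_arc Z upper_half T (\<lambda>s. u s - (b, 0))"
proof -
  have "(\<lambda>(x, y). Z (x - b, y)) = (\<lambda>p. Z (p - (b, 0)))" by auto
  then show ?thesis
    by (simp add: unit_arc_def solution_on_def upper_half_def switching_line_def
        has_vector_derivative_diff_const)
qed

section \<open>The time direction of lower arcs\<close>

lemma nonpos_deriv_at_left_endpoint:
  fixes f :: "real \<Rightarrow> real"
  assumes "(f has_real_derivative l) (at 0 within {0..1})" "f 0 = 0"
    and "\<And>s. s \<in> {0..1} \<Longrightarrow> f s \<le> 0"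
  shows "l \<le> 0"
proof (rule ccontr)
  assume "\<not> l \<le> 0"
  then obtain d where d: "d > 0" "\<And>h. h > 0 \<Longrightarrow> h \<in> {0..1} \<Longrightarrow> h < d \<Longrightarrow> f 0 < f h"
    using has_real_derivative_pos_inc_right[OF assms(1)] by auto
  have "f 0 < f (min 1 (d / 2))"
    using d(1) by (intro d(2)) auto
  moreover have "f (min 1 (d / 2)) \<le> 0"
    using d(1) by (intro assms(3)) auto
  ultimately show False using assms(2) by simp
qed

lemma solution_on_snd_derivative:
  assumes "solution_on Z S I u" "s \<in> I"
  shows "((\<lambda>s. snd (u s)) has_real_derivative snd (Z (u s))) (at s within I)"
proof -
  have "(u has_vector_derivative Z (u s)) (at s within I)"
    using assms by (simp add: solution_on_def)
  then show ?thesis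
    unfolding has_real_derivative_iff_has_vector_derivative
    by (rule bounded_linear.has_vector_derivative[OF bounded_linear_snd])
qed

text \<open>The rescaled arc starts on the switching line and stays below or on it, so the initial
  derivative of its height cannot be positive. A tangential start gives equality.\<close>

lemma half_return_vertical_sign:
  assumes h: "half_return Z lower_half \<psi> x0 \<tau>" and x: "x \<in> {0<..<x0}"
  shows "\<tau> x * snd (Z (x, 0)) \<le> 0"
proof (cases "\<tau> x = 0")
  case False
  define u where "u = (\<lambda>s. \<psi> (\<tau> x * s) (x, 0))"
  have u: "unit_arc Z lower_half (\<tau> x) u"
    unfolding u_def by (rule half_return_unit_arc[OF h x False])
  have u0: "u 0 = (x, 0)" using h x by (simp add: half_return_def u_def)
  have sol: "solution_on (\<lambda>p. \<tau> x *\<^sub>R Z p) lower_half {0..1} u"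
    using u by (simp add: unit_arc_def)
  then have der: "((\<lambda>s. snd (u s)) has_real_derivative snd (\<tau> x *\<^sub>R Z (u 0))) (at 0 within {0..1})"
    by (rule solution_on_snd_derivative) simp
  have le: "snd (u s) \<le> 0" if "s \<in> {0..1}" for s
    using sol that by (simp add: solution_on_def lower_half_def)
  have "snd (\<tau> x *\<^sub>R Z (u 0)) \<le> 0"
    by (rule nonpos_deriv_at_left_endpoint[OF der _ le]) (simp add: u0)
  then show ?thesis using u0 by simp
qed simp

text \<open>
  An arc leaving \<open>(x, 0)\<close> against the time direction of \<open>\<tau>\<close> could only start tangentially. As
  \<open>\<tau> y * snd (Z (y, 0)) \<le> 0\<close> for all \<open>y\<close> near \<open>x\<close>, its depth \<open>h = - snd \<circ> v\<close> satisfies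
  \<open>h' \<le> A * h\<close> and \<open>h 0 = 0\<close>, so it never leaves the switching line.
\<close>
lemma no_unit_arc_against_half_return:
  assumes ll: "locally_lipschitz_field lower_half Z"
    and h: "half_return Z lower_half \<psi> x0 \<tau>"
    and v: "unit_arc Z lower_half T v" and v0: "v 0 = (x, 0)" and x: "x \<in> {0<..<x0}"
    and T: "\<And>y. y \<in> {0<..<x0} \<Longrightarrow> T * \<tau> y < 0"
  shows False
proof -
  have sol: "solution_on (\<lambda>p. T *\<^sub>R Z p) lower_half {0..1} v"
    using v by (simp add: unit_arc_def)
  have cont: "continuous_on {0..1} v" by (rule solution_on_continuous[OF sol])
  have "((\<lambda>s. fst (v s)) \<longlongrightarrow> x) (at 0 within {0..1})"
  proof -
    have "(v \<longlongrightarrow> v 0) (at 0 within {0..1})" using cont by (simp add: continuous_on_def)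
    then show ?thesis using tendsto_fst v0 by fastforce
  qed
  then have "\<forall>\<^sub>F s in at 0 within {0..1}. fst (v s) \<in> {0<..<x0}"
    using x by (intro topological_tendstoD) auto
  then obtain d where d: "0 < d" "\<And>s. s \<in> {0..1} \<Longrightarrow> s \<noteq> 0 \<Longrightarrow> s < d \<Longrightarrow> fst (v s) \<in> {0<..<x0}"
    unfolding eventually_at dist_real_def by auto
  \<comment> \<open>Up to time \<open>r < d\<close> the abscissa stays where
    \<open>half_return\<close> applies; \<open>r < 1\<close> makes \<open>v r\<close> an interior
    point of the arc, which must be off the switching line.\<close>
  define r where "r = min (1/2) (d / 2)"
  have r: "0 < r" "r < 1" "r < d" using d(1) by (auto simp: r_def)
  have inside: "fst (v s) \<in> {0<..<x0}" if "s \<in> {0..r}" for s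
    using d(2)[of s] that r x v0 by (cases "s = 0") auto
  \<comment> \<open>The vertical projections onto the switching line are included, so that
    \<open>L\<close> compares \<open>Z\<close> at \<open>v s\<close> with \<open>Z\<close> at the
    foot point below called \<open>p\<close>, where the vertical sign is known.\<close>
  define K where "K = v ` {0..1} \<union> (\<lambda>s. (fst (v s), 0)) ` {0..1}"
  have "compact K"
    unfolding K_def by (intro compact_Un compact_continuous_image continuous_intros cont) auto
  moreover have "K \<subseteq> lower_half"
    using sol by (auto simp: K_def solution_on_def lower_half_def)
  ultimately obtain L where L: "0 \<le> L"
    "\<And>p q. p \<in> K \<Longrightarrow> q \<in> K \<Longrightarrow> norm (Z p - Z q) \<le> L * norm (p - q)"
    using locally_lipschitz_on_compact[OF ll] by blast
  define A where "A = \<bar>T\<bar> * L"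
  define g where "g = (\<lambda>s. - snd (v s) * exp (- (A * s)))"
  have "g r \<le> g 0"
  proof (rule DERIV_nonpos_imp_decreasing_open[of 0 r g])
    show "0 \<le> r" using r by simp
    have "continuous_on {0..r} v" by (rule continuous_on_subset[OF cont]) (use r in auto)
    then show "continuous_on {0..r} g" unfolding g_def by (intro continuous_intros)
  next
    fix s assume s: "0 < s" "s < r"
    have "((\<lambda>s. snd (v s)) has_real_derivative snd (T *\<^sub>R Z (v s))) (at s within {0..1})"
      by (rule solution_on_snd_derivative[OF sol]) (use s r in auto)
    then have "((\<lambda>s. snd (v s)) has_real_derivative T * snd (Z (v s))) (at s)"
      using s r by (simp add: at_within_Icc_at)
    then have *: "(g has_real_derivative (A * snd (v s) - T * snd (Z (v s))) * exp (- (A * s))) (at s)"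
      unfolding g_def by (auto intro!: derivative_eq_intros simp: algebra_simps)
    define p where "p = (fst (v s), 0::real)"
    have sv: "snd (v s) \<le> 0" using sol s r by (auto simp: solution_on_def lower_half_def)
    have "norm (Z p - Z (v s)) \<le> L * norm (p - v s)"
      using s r by (intro L(2)) (auto simp: K_def p_def)
    moreover have "norm (p - v s) = - snd (v s)"
    proof -
      have "p - v s = (0, - snd (v s))" by (rule prod_eqI) (simp_all add: p_def)
      then show ?thesis using sv by simp
    qed
    moreover have "\<bar>snd (Z p) - snd (Z (v s))\<bar> \<le> norm (Z p - Z (v s))"
      by (metis norm_snd_le prod.collapse real_norm_def snd_diff)
    ultimately have "\<bar>snd (Z p) - snd (Z (v s))\<bar> \<le> - L * snd (v s)" by simp
    then have "\<bar>T\<bar> * \<bar>snd (Z p) - snd (Z (v s))\<bar> \<le> \<bar>T\<bar> * (- L * snd (v s))"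
      by (rule mult_left_mono) simp
    then have 1: "\<bar>T * (snd (Z p) - snd (Z (v s)))\<bar> \<le> - A * snd (v s)"
      by (simp add: A_def abs_mult)
    \<comment> \<open>\<open>T\<close> and \<open>\<tau>\<close> have opposite signs at the foot
      point, which reverses the sign condition on the vertical component.\<close>
    have "\<tau> (fst (v s)) * snd (Z p) \<le> 0" "T * \<tau> (fst (v s)) < 0"
      using half_return_vertical_sign[OF h] T inside[of s] s by (auto simp: p_def)
    then have "0 \<le> T * snd (Z p)"
      by (auto simp: mult_le_0_iff mult_less_0_iff zero_le_mult_iff)
    then have "A * snd (v s) - T * snd (Z (v s)) \<le> 0"
      using 1 by (simp add: right_diff_distrib abs_le_iff)
    then show "\<exists>y. (g has_real_derivative y) (at s) \<and> y \<le> 0"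
      using * by (blast intro: mult_nonpos_nonneg exp_ge_zero)
  qed
  then have "0 \<le> snd (v r)"
    using v0 by (simp add: g_def zero_le_mult_iff)
  moreover have "snd (v r) \<le> 0" using sol r by (auto simp: solution_on_def lower_half_def)
  ultimately have "v r \<in> switching_line" by (simp add: switching_line_def)
  then show False using v r by (simp add: unit_arc_def)
qed

section \<open>Continuity of the half-return maps\<close>

text \<open>\<open>half_return\<close> asserts continuity on the open interval for the time
  \<open>\<tau>\<close> only; for the abscissa it follows from continuous dependence.\<close>

lemma continuous_on_half_map:
  assumes ll: "locally_lipschitz_field S Z" and S: "closed S"
    and h: "half_return Z S \<psi> x0 \<tau>" and \<tau>: "\<And>x. x \<in> {0<..<x0} \<Longrightarrow> \<tau> x \<noteq> 0"
  shows "continuous_on {0<..<x0} (half_map \<psi> \<tau>)"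
proof -
  have "continuous_on {0<..<x0} (\<lambda>x. \<psi> (\<tau> x * 1) (x, 0))"
  proof (rule solution_endpoint_continuous[OF ll S, where T = \<tau> and u = "\<lambda>x s. \<psi> (\<tau> x * s) (x, 0)"])
    show "continuous_on {0<..<x0} \<tau>" using h by (simp add: half_return_def)
    have "continuous_on {0<..<x0} (\<lambda>x::real. (x, 0::real))" by (intro continuous_intros)
    then show "continuous_on {0<..<x0} (\<lambda>x. \<psi> (\<tau> x * 0) (x, 0))"
      using h by (subst continuous_on_cong[OF refl, of _ _ "\<lambda>x. (x, 0)"]) (auto simp: half_return_def)
    show "solution_on (\<lambda>p. \<tau> x *\<^sub>R Z p) S {0..1} (\<lambda>s. \<psi> (\<tau> x * s) (x, 0))"
      if "x \<in> {0<..<x0}" for x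
      using half_return_unit_arc[OF h that \<tau>[OF that]] by (simp add: unit_arc_def)
  qed
  then show ?thesis unfolding half_map_def by (intro continuous_intros) simp
qed

section \<open>Crossing periodic orbits\<close>

lemma orbit_arc_switching:
  assumes "orbit_arc Z S T \<gamma>" "t \<in> {0..T}" "\<gamma> t \<in> switching_line"
  shows "t = 0 \<or> t = T"
proof (rule ccontr)
  assume "\<not> (t = 0 \<or> t = T)"
  then have "t \<in> {0<..<T}" using assms(2) by auto
  then show False using assms(1,3) by (auto simp: orbit_arc_def)
qed

text \<open>Arcs meet the switching line only at their ends, however large they are. Hence the
  neighbourhood claim reduces to bounding two points.\<close>

lemma crossing_periodic_orbit_forward:
  assumes U: "unit_arc Z1 upper_half T U" "0 < T" and V: "unit_arc Z2 lower_half T' V" "0 < T'"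
    and eq: "U 1 = V 0" "V 1 = U 0" and ne: "U 0 \<noteq> U 1"
  shows "\<exists>\<Gamma>. crossing_periodic_orbit (Z1, Z2) \<Gamma> \<and> \<Gamma> \<inter> switching_line \<subseteq> {U 0, U 1}"
proof (intro exI conjI)
  define \<gamma>1 \<gamma>2 where "\<gamma>1 = (\<lambda>t. U (t / T))" and "\<gamma>2 = (\<lambda>t. V (t / T'))"
  have arcs: "orbit_arc Z1 upper_half T \<gamma>1" "orbit_arc Z2 lower_half T' \<gamma>2"
    using U V by (simp_all add: \<gamma>1_def \<gamma>2_def unit_arc_imp_orbit_arc)
  have ends: "\<gamma>1 0 = U 0" "\<gamma>1 T = U 1" "\<gamma>2 0 = V 0" "\<gamma>2 T' = V 1"
    using U(2) V(2) by (simp_all add: \<gamma>1_def \<gamma>2_def)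
  show "crossing_periodic_orbit (Z1, Z2) (\<gamma>1 ` {0..T} \<union> \<gamma>2 ` {0..T'})"
    unfolding crossing_periodic_orbit_def
    by (intro exI[of _ T] exI[of _ T'] exI[of _ \<gamma>1] exI[of _ \<gamma>2]) (simp add: arcs ends eq ne[unfolded eq])
  show "(\<gamma>1 ` {0..T} \<union> \<gamma>2 ` {0..T'}) \<inter> switching_line \<subseteq> {U 0, U 1}"
  proof
    fix q assume "q \<in> (\<gamma>1 ` {0..T} \<union> \<gamma>2 ` {0..T'}) \<inter> switching_line"
    then consider t where "t \<in> {0..T}" "q = \<gamma>1 t" "\<gamma>1 t \<in> switching_line"
      | t where "t \<in> {0..T'}" "q = \<gamma>2 t" "\<gamma>2 t \<in> switching_line" by blast
    then show "q \<in> {U 0, U 1}"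
    proof cases
      case 1
      then show ?thesis using orbit_arc_switching[OF arcs(1)] ends by blast
    next
      case 2
      then show ?thesis using orbit_arc_switching[OF arcs(2)] ends eq by force
    qed
  qed
qed

text \<open>Two arcs from a common start to a common end with durations of opposite sign close up
  once the one run backward in time is reversed.\<close>

lemma unit_arcs_imp_crossing_periodic_orbit:
  assumes U: "unit_arc Z1 upper_half T U" and V: "unit_arc Z2 lower_half T' V"
    and eq: "U 0 = V 0" "U 1 = V 1" and ne: "U 0 \<noteq> U 1" and T: "T * T' < 0"
  shows "\<exists>\<Gamma>. crossing_periodic_orbit (Z1, Z2) \<Gamma> \<and> \<Gamma> \<inter> switching_line \<subseteq> {U 0, U 1}"
proof (cases "0 < T")
  case True
  then have "0 < - T'" using T by (simp add: mult_less_0_iff)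
  then show ?thesis
    using crossing_periodic_orbit_forward[OF U True unit_arc_reverse[OF V]] eq ne by simp
next
  case False
  then have "0 < - T" "0 < T'" using T by (auto simp: mult_less_0_iff)
  then have "\<exists>\<Gamma>. crossing_periodic_orbit (Z1, Z2) \<Gamma> \<and> \<Gamma> \<inter> switching_line \<subseteq> {U 1, U 0}"
    using crossing_periodic_orbit_forward[OF unit_arc_reverse[OF U] _ V] eq ne by simp
  then show ?thesis by (simp add: insert_commute)
qed

text \<open>The interiors of the arcs avoid the switching line, so \<open>q\<close> is one of the
  two junctions. Reversing the arc that ends at \<open>q\<close> makes both start there.\<close>

lemma crossing_periodic_orbit_imp_unit_arcs:
  assumes \<Gamma>: "crossing_periodic_orbit (Z1, Z2) \<Gamma>" and q: "q \<in> \<Gamma>" "q \<in> switching_line"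
  obtains T U T' V where "unit_arc Z1 upper_half T U" "unit_arc Z2 lower_half T' V"
    "T * T' < 0" "U 0 = q" "V 0 = q" "U 1 = V 1"
proof -
  obtain T1 T2 \<gamma>1 \<gamma>2 where
    arcs: "orbit_arc Z1 upper_half T1 \<gamma>1" "orbit_arc Z2 lower_half T2 \<gamma>2"
    and ends: "\<gamma>1 T1 = \<gamma>2 0" "\<gamma>2 T2 = \<gamma>1 0"
    and \<Gamma>_eq: "\<Gamma> = \<gamma>1 ` {0..T1} \<union> \<gamma>2 ` {0..T2}"
    using \<Gamma> unfolding crossing_periodic_orbit_def fst_conv snd_conv by blast
  have T: "0 < T1" "0 < T2" using arcs by (simp_all add: orbit_arc_def)
  note arc1 = orbit_arc_imp_unit_arc[OF arcs(1)]
  note arc2 = orbit_arc_imp_unit_arc[OF arcs(2)]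
  have "q = \<gamma>1 0 \<or> q = \<gamma>2 0"
  proof -
    consider t where "t \<in> {0..T1}" "q = \<gamma>1 t" | t where "t \<in> {0..T2}" "q = \<gamma>2 t"
      using q \<Gamma>_eq by blast
    then show ?thesis
    proof cases
      case 1
      then show ?thesis using orbit_arc_switching[OF arcs(1), of t] q ends by auto
    next
      case 2
      then show ?thesis using orbit_arc_switching[OF arcs(2), of t] q ends by auto
    qed
  qed
  then show ?thesis
  proof
    assume "q = \<gamma>1 0"
    then show ?thesis
      using that[OF arc1 unit_arc_reverse[OF arc2]] T ends by simp
  next
    assume "q = \<gamma>2 0"
    then show ?thesis
      using that[OF unit_arc_reverse[OF arc1] arc2] T ends by simp
  qed
qed

section \<open>Half-return maps\<close>

lemma half_map_endpoint:
  assumes "half_return Z S \<psi> x0 \<tau>" "x \<in> {0<..<x0}"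
  shows "\<psi> (\<tau> x) (x, 0) = (half_map \<psi> \<tau> x, 0)"
  using assms by (auto simp: half_return_def half_map_def switching_line_def intro: prod_eqI)

lemma half_return_arc:
  assumes "half_return Z S \<psi> x0 \<tau>" "x \<in> {0<..<x0}" "\<tau> x \<noteq> 0"
  obtains u where "unit_arc Z S (\<tau> x) u" "u 0 = (x, 0)" "u 1 = (half_map \<psi> \<tau> x, 0)"
proof
  show "unit_arc Z S (\<tau> x) (\<lambda>s. \<psi> (\<tau> x * s) (x, 0))" by (rule half_return_unit_arc[OF assms])
  show "\<psi> (\<tau> x * 0) (x, 0) = (x, 0)" using assms(1,2) by (simp add: half_return_def)
  show "\<psi> (\<tau> x * 1) (x, 0) = (half_map \<psi> \<tau> x, 0)" using half_map_endpoint[OF assms(1,2)] by simp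
qed

lemma constant_sign_on_interval:
  fixes f :: "real \<Rightarrow> real"
  assumes cont: "continuous_on {a<..<b} f" and nz: "\<And>x. x \<in> {a<..<b} \<Longrightarrow> f x \<noteq> 0"
    and xy: "x \<in> {a<..<b}" "y \<in> {a<..<b}"
  shows "0 < f x * f y"
proof (rule ccontr)
  assume "\<not> 0 < f x * f y"
  then have "0 \<in> closed_segment (f x) (f y)"
    by (auto simp: closed_segment_eq_real_ivl zero_less_mult_iff)
  moreover have sub: "closed_segment x y \<subseteq> {a<..<b}"
    using xy by (auto simp: closed_segment_eq_real_ivl split: if_splits)
  ultimately obtain z where "z \<in> closed_segment x y" "f z = 0"
    using IVT'_closed_segment_real continuous_on_subset[OF cont sub] by blast
  then show False using nz sub by blast
qed

section \<open>The shifted displacement function\<close>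

text \<open>Supplies the value at \<open>0\<close>, so that the intermediate value theorem can be
  used on intervals that start at \<open>0\<close>.\<close>

lemma continuous_on_extend_zero:
  fixes f :: "real \<Rightarrow> real"
  assumes cont: "continuous_on {0<..<a} f" and lim: "(f \<longlongrightarrow> 0) (at_right 0)"
  shows "continuous_on {0..<a} (\<lambda>x. if x = 0 then 0 else f x)"
  unfolding continuous_on_def
proof
  fix x assume x: "x \<in> {0..<a}"
  let ?g = "\<lambda>x. if x = 0 then 0 else f x"
  show "(?g \<longlongrightarrow> ?g x) (at x within {0..<a})"
  proof (cases "x = 0")
    case True
    have "at 0 within {0..<a} \<le> at_right (0::real)"
      unfolding at_within_def by (intro inf_mono order_refl) auto
    with lim have "(f \<longlongrightarrow> 0) (at 0 within {0..<a})" by (rule tendsto_mono[rotated])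
    then have "(?g \<longlongrightarrow> 0) (at 0 within {0..<a})"
      by (rule Lim_transform_eventually) (simp add: eventually_at_filter)
    then show ?thesis using True by simp
  next
    case False
    then have x': "x \<in> {0<..<a}" using x by auto
    then have "(f \<longlongrightarrow> f x) (at x)"
      using cont continuous_on_eq_continuous_at[of "{0<..<a}" f] by (auto simp: isCont_def)
    moreover have "\<forall>\<^sub>F y in at x. f y = ?g y"
      by (rule eventually_mono[OF eventually_at_in_open'[of "{0<..<a}" x]]) (use x' in auto)
    ultimately have "(?g \<longlongrightarrow> f x) (at x)" by (rule Lim_transform_eventually)
    then show ?thesis using False by (simp add: tendsto_within_subset[of _ _ _ UNIV])
  qed
qed

text \<open>The extension by \<open>0\<close> takes all values between \<open>f (a / 2)\<close> and
  \<open>0\<close>, and a value other than \<open>0\<close> is not taken at the point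
  \<open>0\<close>.\<close>

lemma attains_small_negative_values:
  fixes f :: "real \<Rightarrow> real"
  assumes cont: "continuous_on {0<..<a} f" and lim: "(f \<longlongrightarrow> 0) (at_right 0)"
    and a: "0 < a" and neg: "\<And>x. x \<in> {0<..<a} \<Longrightarrow> f x < 0"
  obtains \<eta> where "0 < \<eta>" "\<And>v. - \<eta> < v \<Longrightarrow> v < 0 \<Longrightarrow> \<exists>x\<in>{0<..<a}. f x = v"
proof
  let ?g = "\<lambda>x. if x = 0 then 0 else f x"
  show "0 < - f (a / 2)" using neg[of "a / 2"] a by simp
  fix v assume v: "- (- f (a / 2)) < v" "v < 0"
  have "continuous_on {0..a / 2} ?g"
    by (rule continuous_on_subset[OF continuous_on_extend_zero[OF cont lim]]) (use a in auto)
  then obtain x where "0 \<le> x" "x \<le> a / 2" "?g x = v"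
    using IVT2'[of ?g "a / 2" v 0] v a by auto
  then show "\<exists>x\<in>{0<..<a}. f x = v" using v a by (intro bexI[of _ x]) (auto split: if_splits)
qed

text \<open>Here \<open>x\<close> is the abscissa of the right crossing point: the lower arc leads
  to \<open>m x\<close>, the translated upper arc to \<open>b + p (x - b)\<close>. The sign
  \<open>\<kappa>\<close> is constant, so it may be read off at \<open>x1\<close>.\<close>

lemma shifted_displacement_zero:
  fixes p m :: "real \<Rightarrow> real"
  assumes p: "continuous_on {0<..<x0} p" "(p \<longlongrightarrow> 0) (at_right 0)" "\<And>x. x \<in> {0<..<x0} \<Longrightarrow> p x < 0"
    and m: "continuous_on {0<..<x0} m" "(m \<longlongrightarrow> 0) (at_right 0)" "\<And>x. x \<in> {0<..<x0} \<Longrightarrow> m x < 0"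
    and ne: "\<And>x. x \<in> {0<..<x0} \<Longrightarrow> p x \<noteq> m x" and x1: "x1 \<in> {0<..<x0}"
    and \<kappa>: "\<kappa> = sgn (p x1 - m x1)" and \<epsilon>: "0 < \<epsilon>"
  obtains b0 where "0 < b0" "\<And>b. 0 < - \<kappa> * b \<Longrightarrow> - \<kappa> * b < b0 \<Longrightarrow>
    \<exists>x\<in>{0<..<x0}. x - b \<in> {0<..<x0} \<and> x < \<epsilon> \<and> - \<epsilon> < m x \<and> b + p (x - b) = m x"
proof -
  have \<kappa>1: "\<kappa> = 1 \<or> \<kappa> = - 1" using ne[OF x1] by (auto simp: \<kappa> sgn_if)
  have pos: "0 < \<kappa> * (p x - m x)" if "x \<in> {0<..<x0}" for x
  proof -
    have "0 < (p x1 - m x1) * (p x - m x)"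
      using ne by (intro constant_sign_on_interval[of 0 x0 "\<lambda>x. p x - m x"] continuous_intros p(1) m(1) x1 that)
        fastforce
    then show ?thesis by (auto simp: \<kappa> sgn_if zero_less_mult_iff)
  qed
  have "\<forall>\<^sub>F x in at_right 0. - \<epsilon> < m x" using \<epsilon> by (intro order_tendstoD(1)[OF m(2)]) simp
  then obtain c where c: "0 < c" "\<And>x. 0 < x \<Longrightarrow> x < c \<Longrightarrow> - \<epsilon> < m x"
    by (auto simp: eventually_at_right_field)
  \<comment> \<open>The right end of the search interval, fixed before \<open>b\<close>. Every
    positive \<open>x \<le> x2\<close> satisfies both \<open>\<epsilon>\<close> bounds.\<close>
  define x2 where "x2 = min (x0 / 2) (min (c / 2) (\<epsilon> / 2))"
  have x2: "0 < x2" "x2 < x0" "x2 < c" "x2 < \<epsilon>" using x1 c(1) \<epsilon> by (auto simp: x2_def)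
  have "isCont p x2"
    using p(1) x2 continuous_on_eq_continuous_at[of "{0<..<x0}" p] by auto
  then have "isCont (\<lambda>b. \<kappa> * (b + p (x2 - b) - m x2)) 0"
    by (intro continuous_intros isCont_o2[of 0 "\<lambda>b. x2 - b" p]) auto
  then have "((\<lambda>b. \<kappa> * (b + p (x2 - b) - m x2)) \<longlongrightarrow> \<kappa> * (p x2 - m x2)) (at 0)"
    by (simp add: isCont_def)
  then have "\<forall>\<^sub>F b in at 0. 0 < \<kappa> * (b + p (x2 - b) - m x2)"
    using pos[of x2] x2 by (intro order_tendstoD(1)) auto
  then obtain d where d: "0 < d" "\<And>b. b \<noteq> 0 \<Longrightarrow> \<bar>b\<bar> < d \<Longrightarrow> 0 < \<kappa> * (b + p (x2 - b) - m x2)"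
    unfolding eventually_at dist_real_def by auto
  show ?thesis
  proof
    \<comment> \<open>\<open>d\<close> preserves the sign at \<open>x2\<close>, the bound
      \<open>x2\<close> keeps \<open>max 0 b\<close> to its left, and \<open>x0 - x2\<close> keeps
      \<open>x - b\<close> below \<open>x0\<close> when \<open>b\<close> is negative.\<close>
    show "0 < min d (min x2 (x0 - x2))" using d(1) x2 by simp
    fix b assume b: "0 < - \<kappa> * b" "- \<kappa> * b < min d (min x2 (x0 - x2))"
    have abs: "\<bar>b\<bar> < d" "\<bar>b\<bar> < x2" "\<bar>b\<bar> < x0 - x2" "b \<noteq> 0" using b \<kappa>1 by auto
    define P where "P = (\<lambda>x. if x = 0 then 0 else p x)"
    define M where "M = (\<lambda>x. if x = 0 then 0 else m x)"
    define F where "F = (\<lambda>x. \<kappa> * (b + P (x - b) - M x))"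
    have P: "continuous_on {0..<x0} P"
      unfolding P_def by (rule continuous_on_extend_zero[OF p(1,2)])
    have M: "continuous_on {0..<x0} M"
      unfolding M_def by (rule continuous_on_extend_zero[OF m(1,2)])
    have "continuous_on {max 0 b..x2} F"
      unfolding F_def
    proof (intro continuous_intros)
      show "continuous_on {max 0 b..x2} (\<lambda>x. P (x - b))"
        by (rule continuous_on_compose2[OF P]) (use abs in \<open>auto intro!: continuous_intros\<close>)
      show "continuous_on {max 0 b..x2} M"
        by (rule continuous_on_subset[OF M]) (use x2 in auto)
    qed
    moreover have "0 < F x2"
      using d(2)[of b] abs x2 by (auto simp: F_def P_def M_def)
    \<comment> \<open>At this end one of the two maps takes its boundary value \<open>0\<close>. For
      \<open>b > 0\<close> the bracket is \<open>b - m b > 0\<close> and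
      \<open>\<kappa> = -1\<close>; for \<open>b < 0\<close> it is \<open>b + p (- b) < 0\<close>
      and \<open>\<kappa> = 1\<close>.\<close>
    moreover have Fa: "F (max 0 b) < 0"
    proof (cases "0 < b")
      case True
      then have "m b < 0" using abs x2 by (intro m(3)) auto
      then show ?thesis using True b(1) \<kappa>1 by (auto simp: F_def P_def M_def)
    next
      case False
      then have "p (- b) < 0" using abs x2 by (intro p(3)) auto
      then show ?thesis using False b(1) \<kappa>1 by (auto simp: F_def P_def M_def)
    qed
    moreover have "max 0 b \<le> x2" using abs x2 by auto
    ultimately obtain x where x: "max 0 b \<le> x" "x \<le> x2" "F x = 0"
      using IVT'[of F "max 0 b" 0 x2] by (metis less_imp_le)
    \<comment> \<open>Strictness makes \<open>x\<close> and \<open>x - b\<close> positive, so the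
      extensions \<open>P\<close> and \<open>M\<close> agree with \<open>p\<close> and
      \<open>m\<close> there.\<close>
    then have "max 0 b < x" using Fa by (metis less_irrefl order_le_less)
    then have "0 < x" "b < x" by auto
    moreover have "b + P (x - b) - M x = 0" using x(3) \<kappa>1 by (auto simp: F_def)
    ultimately have "b + p (x - b) = m x" by (simp add: P_def M_def)
    moreover have "x \<in> {0<..<x0}" "x - b \<in> {0<..<x0}" "x < \<epsilon>" "- \<epsilon> < m x"
      using \<open>0 < x\<close> \<open>b < x\<close> x(2) x2 abs c(2)[of x] by auto
    ultimately show "\<exists>x\<in>{0<..<x0}. x - b \<in> {0<..<x0} \<and> x < \<epsilon> \<and> - \<epsilon> < m x \<and> b + p (x - b) = m x"
      by blast
  qed
qed

theorem theorem1:
  fixes Zp Zm :: field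
    and \<psi>p \<psi>m :: "real \<Rightarrow> plane \<Rightarrow> plane"
    and x0 x1 \<mu> :: real
    and \<tau>p \<tau>m :: "real \<Rightarrow> real"
  assumes "locally_lipschitz_field upper_half Zp"
    and "locally_lipschitz_field lower_half Zm"
    and "H1 Zp Zm \<psi>p \<psi>m x0 \<tau>p \<tau>m"
    and "x1 \<in> {0<..<x0}"
    and "\<mu> = mu_sign \<psi>p \<psi>m \<tau>p \<tau>m x1"
  shows "\<forall>\<epsilon>>0. \<exists>b0>0. \<forall>b. 0 < \<mu> * b \<and> \<mu> * b < b0 \<longrightarrow>
           (\<exists>\<Gamma>. crossing_periodic_orbit (shifted_family Zp Zm b) \<Gamma> \<and>
                \<Gamma> \<inter> switching_line \<subseteq> ball (0, 0) \<epsilon>) \<and>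
           (\<forall>\<Gamma> xs. limit_cycle (shifted_family Zp Zm b) \<Gamma> \<and> (xs, 0) \<in> \<Gamma> \<and> xs > 0 \<longrightarrow>
                xs > max 0 b)"
proof (intro allI impI)
  fix \<epsilon> :: real assume \<epsilon>: "0 < \<epsilon>"
  define p m where "p = half_map \<psi>p \<tau>p" and "m = half_map \<psi>m \<tau>m"
  have x0: "0 < x0" and hp: "half_return Zp upper_half \<psi>p x0 \<tau>p"
    and hm: "half_return Zm lower_half \<psi>m x0 \<tau>m"
    and opp: "\<tau>p x * \<tau>m x < 0" and ne: "p x \<noteq> m x" if "x \<in> {0<..<x0}" for x
    using assms(3) that by (simp_all add: H1_def p_def m_def)
  \<comment> \<open>These facts do not depend on \<open>x\<close>; the point \<open>x1\<close>
    discharges the premise they share with the pointwise ones.\<close>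
  note x0 = x0[OF assms(4)] and hp = hp[OF assms(4)] and hm = hm[OF assms(4)]
  have \<tau>_nz: "\<tau>p x \<noteq> 0" "\<tau>m x \<noteq> 0" if "x \<in> {0<..<x0}" for x
    using opp[OF that] by auto
  have \<tau>m_sign: "0 < \<tau>m x * \<tau>m y" if "x \<in> {0<..<x0}" "y \<in> {0<..<x0}" for x y
    using hm \<tau>_nz(2) that by (intro constant_sign_on_interval) (simp_all add: half_return_def)
  \<comment> \<open>Two different points are needed: the shift makes the unshifted upper arc start
    at another abscissa than the lower one.\<close>
  have \<tau>_opp: "\<tau>p x * \<tau>m y < 0" if "x \<in> {0<..<x0}" "y \<in> {0<..<x0}" for x y
    using opp[OF that(1)] \<tau>m_sign[OF that] by (auto simp: mult_less_0_iff zero_less_mult_iff)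
  have closed: "closed upper_half" "closed lower_half"
    unfolding upper_half_def lower_half_def by (intro closed_Collect_le continuous_intros)+
  have p: "continuous_on {0<..<x0} p" "(p \<longlongrightarrow> 0) (at_right 0)"
    and p_neg: "p x < 0" if "x \<in> {0<..<x0}" for x
    using hp that continuous_on_half_map[OF assms(1) closed(1) hp \<tau>_nz(1)]
    by (simp_all add: half_return_def p_def)
  have m: "continuous_on {0<..<x0} m" "(m \<longlongrightarrow> 0) (at_right 0)"
    and m_neg: "m x < 0" if "x \<in> {0<..<x0}" for x
    using hm that continuous_on_half_map[OF assms(2) closed(2) hm \<tau>_nz(2)]
    by (simp_all add: half_return_def m_def)
  note p = p[OF assms(4)] and m = m[OF assms(4)]
  have \<mu>: "\<mu> = - sgn (p x1 - m x1)"
    by (simp add: assms(5) mu_sign_def displacement_def delta_sign_def p_def m_def sgn_mult)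
  obtain bE where bE: "0 < bE" "\<And>b. 0 < \<mu> * b \<Longrightarrow> \<mu> * b < bE \<Longrightarrow>
    \<exists>x\<in>{0<..<x0}. x - b \<in> {0<..<x0} \<and> x < \<epsilon> \<and> - \<epsilon> < m x \<and> b + p (x - b) = m x"
    unfolding \<mu> by (rule shifted_displacement_zero[OF p p_neg m m_neg ne assms(4) refl \<epsilon>]) blast+
  obtain \<eta> where \<eta>: "0 < \<eta>" "\<And>v. - \<eta> < v \<Longrightarrow> v < 0 \<Longrightarrow> \<exists>x\<in>{0<..<x0}. p x = v"
    using attains_small_negative_values[OF p x0 p_neg] by blast
  have "\<forall>\<^sub>F x in at_right 0. - (\<eta> / 2) < m x" using \<eta>(1) by (intro order_tendstoD(1)[OF m(2)]) simp
  then obtain c where c: "0 < c" "\<And>x. 0 < x \<Longrightarrow> x < c \<Longrightarrow> - (\<eta> / 2) < m x"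
    by (auto simp: eventually_at_right_field)
  \<comment> \<open>\<open>bE\<close> serves existence. If \<open>0 < xs \<le> b < b0\<close>, then
    \<open>x0\<close> puts \<open>xs\<close> in the domain of \<open>m\<close>, while
    \<open>c\<close> and \<open>\<eta> / 2\<close> give \<open>m xs - b > - \<eta>\<close>, a value
    that \<open>p\<close> attains.\<close>
  define b0 where "b0 = min bE (min (\<eta> / 2) (min c x0))"
  have b0: "b0 \<le> bE" "b0 \<le> \<eta> / 2" "b0 \<le> c" "b0 \<le> x0" by (auto simp: b0_def)
  have exist: "\<exists>\<Gamma>. crossing_periodic_orbit (shifted_family Zp Zm b) \<Gamma> \<and>
      \<Gamma> \<inter> switching_line \<subseteq> ball (0, 0) \<epsilon>" if b: "0 < \<mu> * b" "\<mu> * b < b0" for b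
  proof -
    obtain x where x: "x \<in> {0<..<x0}" "x - b \<in> {0<..<x0}" "x < \<epsilon>" "- \<epsilon> < m x" "b + p (x - b) = m x"
      using bE(2)[of b] b b0 by force
    obtain u where u: "unit_arc Zp upper_half (\<tau>p (x - b)) u" "u 0 = (x - b, 0)" "u 1 = (p (x - b), 0)"
      using half_return_arc[OF hp x(2) \<tau>_nz(1)[OF x(2)]] unfolding p_def by blast
    obtain v where v: "unit_arc Zm lower_half (\<tau>m x) v" "v 0 = (x, 0)" "v 1 = (m x, 0)"
      using half_return_arc[OF hm x(1) \<tau>_nz(2)[OF x(1)]] unfolding m_def by blast
    define U where "U = (\<lambda>s. u s + (b, 0))"
    have "unit_arc (\<lambda>(x, y). Zp (x - b, y)) upper_half (\<tau>p (x - b)) U"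
      using u(1) by (simp add: unit_arc_translate U_def)
    moreover have U: "U 0 = v 0" "U 1 = v 1" "U 0 \<noteq> U 1"
      using u v x(5) m_neg[OF x(1)] x(1) by (auto simp: U_def)
    ultimately obtain \<Gamma> where "crossing_periodic_orbit (shifted_family Zp Zm b) \<Gamma>"
      "\<Gamma> \<inter> switching_line \<subseteq> {U 0, U 1}"
      using unit_arcs_imp_crossing_periodic_orbit[OF _ v(1)] \<tau>_opp[OF x(2,1)]
      unfolding shifted_family_def by metis
    moreover have "{U 0, U 1} \<subseteq> ball (0, 0) \<epsilon>"
      using U v x m_neg[OF x(1)] by (simp add: dist_prod_def)
    ultimately show ?thesis by blast
  qed
  have right: "max 0 b < xs"
    if b: "0 < \<mu> * b" "\<mu> * b < b0" and \<Gamma>: "crossing_periodic_orbit (shifted_family Zp Zm b) \<Gamma>"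
      and xs: "(xs, 0) \<in> \<Gamma>" "0 < xs" for b \<Gamma> xs
  proof (rule ccontr)
    assume "\<not> max 0 b < xs"
    then have xb: "xs \<le> b" "0 < b" using xs(2) by auto
    then have "\<mu> = 1" using b(1) by (auto simp: \<mu> sgn_if zero_less_mult_iff split: if_splits)
    then have "b < b0" using b by simp
    then have xI: "xs \<in> {0<..<x0}" and "xs < c" using xb xs(2) b0 by auto
    obtain T U T' V where U: "unit_arc (\<lambda>(x, y). Zp (x - b, y)) upper_half T U"
      and V: "unit_arc Zm lower_half T' V" and TT': "T * T' < 0"
      and start: "U 0 = (xs, 0)" "V 0 = (xs, 0)" and stop: "U 1 = V 1"
      by (rule crossing_periodic_orbit_imp_unit_arcs[OF \<Gamma>[unfolded shifted_family_def] xs(1)])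
        (simp add: switching_line_def)
    \<comment> \<open>Uniqueness compares arcs with the same time direction only, so a lower arc
      leaving \<open>(xs, 0)\<close> in the opposite direction has to be excluded first.\<close>
    have T': "0 < T' * \<tau>m xs"
    proof (rule ccontr)
      assume "\<not> 0 < T' * \<tau>m xs"
      moreover have "T' \<noteq> 0" using TT' by fastforce
      ultimately have "T' * \<tau>m xs < 0"
        using \<tau>_nz(2)[OF xI] by (simp add: not_less order.order_iff_strict)
      then have "T' * \<tau>m y < 0" if "y \<in> {0<..<x0}" for y
        using \<tau>m_sign[OF xI that] by (auto simp: mult_less_0_iff zero_less_mult_iff)
      then show False by (rule no_unit_arc_against_half_return[OF assms(2) hm V start(2) xI])
    qed
    obtain v where v: "unit_arc Zm lower_half (\<tau>m xs) v" "v 0 = (xs, 0)" "v 1 = (m xs, 0)"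
      using half_return_arc[OF hm xI \<tau>_nz(2)[OF xI]] unfolding m_def by blast
    have "V 1 = (m xs, 0)"
      using unit_arc_unique[OF assms(2) V v(1) _ T'] start v by simp
    moreover have "- \<eta> < m xs - b" "m xs - b < 0"
      using c(2)[OF xs(2) \<open>xs < c\<close>] \<open>b < b0\<close> b0 m_neg[OF xI] xb by auto
    then obtain y where y: "y \<in> {0<..<x0}" "p y = m xs - b" using \<eta>(2) by blast
    obtain u where u: "unit_arc Zp upper_half (\<tau>p y) u" "u 0 = (y, 0)" "u 1 = (m xs - b, 0)"
      using half_return_arc[OF hp y(1) \<tau>_nz(1)[OF y(1)]] y(2) unfolding p_def by metis
    \<comment> \<open>After translation both upper arcs end at \<open>(m xs - b, 0)\<close>, so
      uniqueness is applied to their reversals. Their directions agree: \<open>T\<close> and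
      \<open>\<tau>p y\<close> are both opposite in sign to \<open>\<tau>m xs\<close>.\<close>
    have "0 < - T * - \<tau>p y"
      using TT' T' \<tau>_opp[OF y(1) xI] by (auto simp: mult_less_0_iff zero_less_mult_iff)
    moreover have "unit_arc Zp upper_half (- T) (\<lambda>s. U (1 - s) - (b, 0))"
      using unit_arc_reverse[OF U] by (simp add: unit_arc_translate)
    ultimately have "(xs - b, 0) = (y, 0::real)"
      using unit_arc_unique[OF assms(1) _ unit_arc_reverse[OF u(1)], of "- T" "\<lambda>s. U (1 - s) - (b, 0)"]
        start stop u \<open>V 1 = (m xs, 0)\<close> by simp
    then show False using y(1) xb by simp
  qed
  show "\<exists>b0>0. \<forall>b. 0 < \<mu> * b \<and> \<mu> * b < b0 \<longrightarrow>
           (\<exists>\<Gamma>. crossing_periodic_orbit (shifted_family Zp Zm b) \<Gamma> \<and>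
                \<Gamma> \<inter> switching_line \<subseteq> ball (0, 0) \<epsilon>) \<and>
           (\<forall>\<Gamma> xs. limit_cycle (shifted_family Zp Zm b) \<Gamma> \<and> (xs, 0) \<in> \<Gamma> \<and> xs > 0 \<longrightarrow>
                xs > max 0 b)"
  proof (intro exI[of _ b0] conjI allI impI)
    show "0 < b0" using bE(1) \<eta>(1) c(1) x0 by (simp add: b0_def)
  next
    fix b assume "0 < \<mu> * b \<and> \<mu> * b < b0"
    then show "\<exists>\<Gamma>. crossing_periodic_orbit (shifted_family Zp Zm b) \<Gamma> \<and>
        \<Gamma> \<inter> switching_line \<subseteq> ball (0, 0) \<epsilon>"
      using exist[of b] by blast
  next
    fix b \<Gamma> xs assume b: "0 < \<mu> * b \<and> \<mu> * b < b0"
      and \<Gamma>: "limit_cycle (shifted_family Zp Zm b) \<Gamma> \<and> (xs, 0) \<in> \<Gamma> \<and> 0 < xs"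
    show "max 0 b < xs"
      using b \<Gamma> by (intro right[of b \<Gamma> xs]) (simp_all add: limit_cycle_def)
  qed
qed

end
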